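(* Let $\theta_1,\theta_2\in\mathfrak{F}$. Then the following statements are equivalent: (1) $\theta_1\,\Delta\,\theta_2$, i.e. there is a constant $C>0$ such that $\theta_1(t)\le\theta_2(Ct)$ for all $t\ge 0$. (2) $\mathcal{H}_w^{\theta_2}(\mathbb{R}^n)\subseteq\mathcal{H}_w^{\theta_1}(\mathbb{R}^n)$. (3) There exists a constant $C>0$ such that $\|h\|_{H_w^{\theta_1}(\mathbb{R}^n)}\le C\|h\|_{H_w^{\theta_2}(\mathbb{R}^n)}$ for every $h\in\mathcal{H}_w^{\theta_2}(\mathbb{R}^n)$.
   Context: Let $\nu_\infty$ denote Lebesgue measure on $\mathbb{R}^n$. Young function: an even function $\theta:\mathbb{R}\to[0,\infty]$ with $\theta(0)=0$ and $\theta(x)\to\infty$ as $x\to\infty$ (convexity is not assumed). $\mathfrak{F}$ is the class of Young functions $\theta$ whose restriction to $[0,\infty)$ is an increasing, continuous, concave bijection of $[0,\infty)$ onto $[0,\infty)$ with $\theta(0)=0$, $\lim_{t\to0}\theta(t)=0$, $\lim_{t\to\infty}\theta(t)=\infty$. Henstock (Henstock–Kurzweil) integral: for a compact interval $A=\prod_{i=1}^n[z_i,w_i]$, a function $f:A\to\mathbb{R}$ is Henstock integrable with integral $L$ if for every $\varepsilon>0$ there is a gauge $\delta:A\to(0,\infty)$ such that $|\sum_{i=1}^m f(x_i)\nu_\infty(J_i)-L|<\varepsilon$ for every partition $\{(J_i,x_i)\}_{i=1}^m$ of $A$ into non-overlapping closed intervals with $x_i\in J_i\subset B(x_i,\delta(x_i))$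 (balls in the maximum norm). For a compact set $K\subset\mathbb{R}^n$, $f$ is Henstock integrable on $K$ if $f\chi_K$ (extended by $0$) is Henstock integrable on a compact interval containing $K$. $HK_{loc}(\mathbb{R}^n)$ is the set of measurable $h:\mathbb{R}^n\to\mathbb{R}$ such that $h\chi_K$ is Henstock integrable on $K$ for every compact $K\subset\mathbb{R}^n$. For measurable $h$ and $t>0$ put $\nu_\infty(h,t)=\nu_\infty(\{x\in\mathbb{R}^n:|h(x)|>t\})$. For a Young function $\theta$, $$\|h\|_{H_w^\theta(\mathbb{R}^n)}=\inf\Big\{\alpha>0:\ \sup_{t>0}\theta(t)\,\nu_\infty\big(\tfrac{h}{\alpha},t\big)\le1\Big\},\qquad \inf\emptyset=+\infty,$$ and the weak Henstock–Orlicz space is $\mathcal{H}_w^\theta(\mathbb{R}^n)=\{h\in HK_{loc}(\mathbb{R}^n):\|h\|_{H_w^\theta(\mathbb{R}^n)}<\infty\}$, where functions equal almost everywhere are identified. *)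

theory Defs
  imports "HOL-Analysis.Analysis"
begin

text \<open>Functions with values in \<open>[0,\<infinity>]\<close> are modelled by the type \<^typ>\<open>ennreal\<close>.\<close>

definition young_function :: "(real \<Rightarrow> ennreal) \<Rightarrow> bool" where
  "young_function \<theta> \<longleftrightarrow>
     (\<forall>x. \<theta> (- x) = \<theta> x) \<and> \<theta> 0 = 0 \<and> (\<theta> \<longlongrightarrow> \<infinity>) at_top"

text \<open>The class of concave Young functions. The bijection condition forces \<open>\<theta>\<close> to be finite, so
  that passing to real values in the concavity condition loses nothing.\<close>

definition concave_young :: "(real \<Rightarrow> ennreal) set" where
  "concave_young = {\<theta>. young_function \<theta> \<and>
     strict_mono_on {0..} \<theta> \<and>
     continuous_on {0..} \<theta> \<and>
     concave_on {0..} (\<lambda>t. enn2real (\<theta> t)) \<and>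
     bij_betw \<theta> {0..} {y. y < \<infinity>} \<and>
     (\<theta> \<longlongrightarrow> 0) (at 0) \<and>
     (\<theta> \<longlongrightarrow> \<infinity>) at_top}"

definition young_dominated :: "(real \<Rightarrow> ennreal) \<Rightarrow> (real \<Rightarrow> ennreal) \<Rightarrow> bool" where
  "young_dominated \<theta>1 \<theta>2 \<longleftrightarrow> (\<exists>C>0. \<forall>t\<ge>0. \<theta>1 t \<le> \<theta>2 (C * t))"

text \<open>On \<^term>\<open>cbox a b\<close>, \<^const>\<open>integrable_on\<close> is the gauge integral. The library takes gauges to be
  assignments of open neighbourhoods; as all norms are equivalent, this gives the
  same integral as gauges \<open>\<delta> > 0\<close> with balls in the maximum norm.\<close>

definition henstock_integrable_on_compact ::
  "(real ^ 'n \<Rightarrow> real) \<Rightarrow> (real ^ 'n) set \<Rightarrow> bool" where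
  "henstock_integrable_on_compact f K \<longleftrightarrow>
     (\<exists>a b. K \<subseteq> cbox a b \<and> (\<lambda>x. f x * indicator K x) integrable_on cbox a b)"

definition HK_loc :: "(real ^ 'n \<Rightarrow> real) set" where
  "HK_loc = {h. h \<in> borel_measurable lebesgue \<and>
     (\<forall>K. compact K \<longrightarrow> henstock_integrable_on_compact (\<lambda>x. h x * indicator K x) K)}"

definition distribution_fun :: "(real ^ 'n \<Rightarrow> real) \<Rightarrow> real \<Rightarrow> ennreal" where
  "distribution_fun h t = emeasure lebesgue {x. \<bar>h x\<bar> > t}"

text \<open>The infimum is taken in \<^typ>\<open>ennreal\<close>, where \<open>Inf {} = \<infinity>\<close>.\<close>

definition weak_gauge :: "(real \<Rightarrow> ennreal) \<Rightarrow> (real ^ 'n \<Rightarrow> real) \<Rightarrow> ennreal" where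
  "weak_gauge \<theta> h =
     Inf {ennreal \<alpha> |\<alpha>. \<alpha> > 0 \<and>
       (SUP t\<in>{0<..}. \<theta> t * distribution_fun (\<lambda>x. h x / \<alpha>) t) \<le> 1}"

definition ae_equal :: "((real ^ 'n \<Rightarrow> real) \<times> (real ^ 'n \<Rightarrow> real)) set" where
  "ae_equal = {(f, g). AE x in lebesgue. f x = g x}"

text \<open>Elements of the space are classes of functions modulo equality almost everywhere.\<close>

definition weak_henstock_orlicz ::
  "(real \<Rightarrow> ennreal) \<Rightarrow> (real ^ 'n \<Rightarrow> real) set set" where
  "weak_henstock_orlicz \<theta> = {h \<in> HK_loc. weak_gauge \<theta> h < \<infinity>} // ae_equal"

text \<open>The value of \<^const>\<open>weak_gauge\<close> on a class; it does not depend on the representative,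
  see \<open>weak_norm_class\<close> below.\<close>

definition weak_norm :: "(real \<Rightarrow> ennreal) \<Rightarrow> (real ^ 'n \<Rightarrow> real) set \<Rightarrow> ennreal" where
  "weak_norm \<theta> c = the_elem (weak_gauge \<theta> ` c)"

lemma equiv_ae_equal: "equiv UNIV ae_equal"
proof (rule equivI)
  show "trans ae_equal"
  proof (rule transI)
    fix f g h :: "real ^ 'n \<Rightarrow> real"
    assume "(f, g) \<in> ae_equal" "(g, h) \<in> ae_equal"
    then have "AE x in lebesgue. f x = g x" "AE x in lebesgue. g x = h x"
      by (auto simp: ae_equal_def)
    then have "AE x in lebesgue. f x = h x" by eventually_elim simp
    then show "(f, h) \<in> ae_equal" by (simp add: ae_equal_def)
  qed
  show "refl ae_equal"
    by (rule refl_onI) (simp add: ae_equal_def)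
  show "sym ae_equal"
  proof (rule symI)
    fix f g :: "real ^ 'n \<Rightarrow> real"
    assume "(f, g) \<in> ae_equal"
    then have "AE x in lebesgue. f x = g x" by (simp add: ae_equal_def)
    then have "AE x in lebesgue. g x = f x" by eventually_elim simp
    then show "(g, f) \<in> ae_equal" by (simp add: ae_equal_def)
  qed
qed simp

lemma distribution_fun_cong_AE:
  fixes f g :: "real ^ 'n \<Rightarrow> real"
  assumes "AE x in lebesgue. f x = g x"
  shows "distribution_fun f t = distribution_fun g t"
proof -
  have "{x. \<bar>f x\<bar> > t} \<in> sets lebesgue \<longleftrightarrow> {x. \<bar>g x\<bar> > t} \<in> sets lebesgue"
  proof -
    have *: "{x. \<bar>v x\<bar> > t} \<in> sets lebesgue"
      if "AE x in lebesgue. u x = v x" "{x. \<bar>u x\<bar> > t} \<in> sets lebesgue"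
      for u v :: "real ^ 'n \<Rightarrow> real"
    proof (rule complete_measure.in_sets_AE[OF completion.complete_measure_axioms])
      show "AE x in lebesgue. x \<in> {x. \<bar>u x\<bar> > t} \<longleftrightarrow> x \<in> {x. \<bar>v x\<bar> > t}"
        using that(1) by eventually_elim simp
      show "{x. \<bar>u x\<bar> > t} \<in> sets lebesgue" by (rule that(2))
      show "{x. \<bar>v x\<bar> > t} \<subseteq> space lebesgue" by simp
    qed
    have "AE x in lebesgue. g x = f x"
      using assms by eventually_elim simp
    with assms * show ?thesis by blast
  qed
  moreover have "AE x in lebesgue. x \<in> {x. \<bar>f x\<bar> > t} \<longleftrightarrow> x \<in> {x. \<bar>g x\<bar> > t}"
    using assms by eventually_elim simp
  ultimately show ?thesis
    unfolding distribution_fun_def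
    by (cases "{x. \<bar>f x\<bar> > t} \<in> sets lebesgue")
      (rule emeasure_eq_AE, assumption, blast, blast, simp only: emeasure_notin_sets not_False_eq_True)
qed

lemma weak_gauge_respects: "weak_gauge \<theta> respects ae_equal"
proof (rule congruentI)
  fix f g :: "real ^ 'n \<Rightarrow> real"
  assume "(f, g) \<in> ae_equal"
  then have fg: "AE x in lebesgue. f x = g x" by (simp add: ae_equal_def)
  have "distribution_fun (\<lambda>x. f x / \<alpha>) t = distribution_fun (\<lambda>x. g x / \<alpha>) t" for \<alpha> t
    by (rule distribution_fun_cong_AE) (use fg in eventually_elim, simp)
  then show "weak_gauge \<theta> f = weak_gauge \<theta> g" by (simp add: weak_gauge_def)
qed

lemma weak_norm_class: "weak_norm \<theta> (ae_equal `` {h}) = weak_gauge \<theta> h"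
proof -
  have "h \<in> ae_equal `` {h}"
    by (simp add: ae_equal_def)
  moreover have "weak_gauge \<theta> g = weak_gauge \<theta> h" if "g \<in> ae_equal `` {h}" for g
    using congruentD[OF weak_gauge_respects, of h g \<theta>] that by simp
  ultimately have "weak_gauge \<theta> ` (ae_equal `` {h}) = {weak_gauge \<theta> h}"
    by blast
  then show ?thesis by (simp add: weak_norm_def)
qed

end

theory Submission
  imports Defs "HOL-Library.Nat_Bijection" "HOL-Real_Asymp.Real_Asymp"
begin

text \<open>Only the necessity of domination needs an idea. It is tested on a function \<open>h\<close> whose distribution
  function lies between \<open>1 / \<theta>2 (2 t)\<close> and \<open>1 / \<theta>2 t\<close>: such an \<open>h\<close> has finite \<open>\<theta>2\<close>-gauge, and finiteness
  of its \<open>\<theta>1\<close>-gauge is \<open>\<theta>1 t \<le> \<theta>2 (2 \<alpha> t)\<close>. One takes \<open>h = 2\<^sup>k\<close> on a set of measure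
  \<open>1 / \<theta>2 (2\<^sup>k) - 1 / \<theta>2 (2\<^sup>k\<^sup>+\<^sup>1)\<close>, \<open>k \<in> \<int>\<close>, so that the measures telescope. As \<open>1 / \<theta>2\<close> is never
  integrable at infinity, the sets must not accumulate: they are balls moving off to infinity, which
  makes \<open>h\<close> locally bounded.\<close>

section \<open>Disjoint balls of prescribed measure that leave every bounded set\<close>

lemma locally_finite_sets_with_measures:
  fixes m :: "nat \<Rightarrow> real"
  assumes m: "\<And>j. m j \<ge> 0"
  obtains E :: "nat \<Rightarrow> 'a::euclidean_space set"
  where "\<And>j. E j \<in> sets lebesgue" "disjoint_family E" "\<And>j. emeasure lebesgue (E j) = ennreal (m j)"
    "\<And>j x. x \<in> E j \<Longrightarrow> real j \<le> norm x"
proof -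
  define d where "d = DIM('a)"
  have d: "d > 0" by (simp add: d_def)
  define c where "c = unit_ball_vol (real d)"
  have c: "c > 0" by (simp add: c_def)
  \<comment> \<open>The radius is solved from the volume formula
    \<open>c * \<rho> j ^ d = m j\<close>; for \<open>m j = 0\<close> the open ball is
    empty.\<close>
  define \<rho> where "\<rho> j = root d (m j / c)" for j
  have \<rho>: "\<rho> j \<ge> 0" "c * \<rho> j ^ d = m j" for j
    using d c m[of j] by (simp_all add: \<rho>_def)
  \<comment> \<open>The \<open>j\<close>-th ball will sit in the spherical shell between the radii
    \<open>\<sigma> j\<close> and \<open>\<sigma> (Suc j)\<close>. The width has room for the
    diameter, and the extra 1 forces \<open>\<sigma> j\<close> to be at least \<open>j\<close> even
    when the radii are summable.\<close>
  define \<sigma> where "\<sigma> j = (\<Sum>i<j. 2 * \<rho> i + 1)" for j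
  have \<sigma>_Suc: "\<sigma> (Suc j) = \<sigma> j + 2 * \<rho> j + 1" for j by (simp add: \<sigma>_def)
  have \<sigma>_ge: "real j \<le> \<sigma> j" for j
  proof (induction j)
    case (Suc j) then show ?case using \<rho>(1)[of j] by (simp add: \<sigma>_Suc)
  qed (simp add: \<sigma>_def)
  have \<sigma>_mono: "\<sigma> i \<le> \<sigma> j" if "i \<le> j" for i j
    by (rule lift_Suc_mono_le[OF _ that]) (use \<rho>(1) in \<open>simp add: \<sigma>_Suc add_nonneg_nonneg\<close>)
  obtain e :: 'a where e: "norm e = 1"
    using vector_choose_size[of 1] by auto
  define E where "E j = ball ((\<sigma> j + \<rho> j) *\<^sub>R e) (\<rho> j)" for j
  have shell: "\<sigma> j < norm x" "norm x < \<sigma> (Suc j)" if "x \<in> E j" for j x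
  proof -
    have "norm ((\<sigma> j + \<rho> j) *\<^sub>R e) = \<sigma> j + \<rho> j"
      using e \<rho>(1)[of j] \<sigma>_ge[of j] by simp
    moreover have "norm ((\<sigma> j + \<rho> j) *\<^sub>R e - x) < \<rho> j"
      using that by (simp add: E_def dist_norm)
    ultimately show "\<sigma> j < norm x" "norm x < \<sigma> (Suc j)"
      using norm_triangle_ineq2[of "(\<sigma> j + \<rho> j) *\<^sub>R e" x]
        norm_triangle_ineq3[of "(\<sigma> j + \<rho> j) *\<^sub>R e" x] by (auto simp: \<sigma>_Suc)
  qed
  show thesis
  proof
    show "E j \<in> sets lebesgue" for j by (simp add: E_def)
    have "E i \<inter> E j = {}" if "i < j" for i j
      using shell(2)[of _ i] shell(1)[of _ j] \<sigma>_mono[of "Suc i" j] that by fastforce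
    then show "disjoint_family E"
      unfolding disjoint_family_on_def by (metis inf_commute linorder_neqE_nat)
    show "emeasure lebesgue (E j) = ennreal (m j)" for j
      using \<rho>[of j] by (simp add: E_def emeasure_ball c_def d_def)
    show "real j \<le> norm x" if "x \<in> E j" for j x
      using shell(1)[OF that] \<sigma>_ge[of j] by linarith
  qed
qed

section \<open>A locally Henstock integrable function with prescribed distribution\<close>

text \<open>On an interval containing \<open>K\<close> the cut-off function is measurable and
  dominated by a constant, hence integrable. This is how the test function is shown to lie in
  \<open>HK_loc\<close>.\<close>

lemma HK_loc_locally_bounded:
  fixes h :: "real ^ 'n \<Rightarrow> real"
  assumes meas: "h \<in> borel_measurable lebesgue"
    and bdd: "\<And>N::nat. \<exists>B. \<forall>x. norm x \<le> real N \<longrightarrow> \<bar>h x\<bar> \<le> B"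
  shows "h \<in> HK_loc"
proof -
  have "henstock_integrable_on_compact (\<lambda>x. h x * indicator K x) K" if K: "compact K" for K
  proof -
    obtain a where a: "K \<subseteq> cbox (- a) a"
      using bounded_subset_cbox_symmetric[OF compact_imp_bounded[OF K]] by blast
    obtain r where r: "\<And>x. x \<in> K \<Longrightarrow> norm x \<le> r"
      using compact_imp_bounded[OF K] by (auto simp: bounded_iff)
    obtain N :: nat where N: "r \<le> real N" using real_arch_simple by blast
    obtain B where B: "\<And>x. norm x \<le> real N \<Longrightarrow> \<bar>h x\<bar> \<le> B" using bdd by blast
    have B0: "B \<ge> 0" using B[of 0] by simp
    have [measurable]: "h \<in> borel_measurable lebesgue" "K \<in> sets lebesgue"
      using meas K by (auto intro: fmeasurableD lmeasurable_compact)
    \<comment> \<open>The indicator occurs twice because \<open>HK_loc\<close> and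
      \<open>henstock_integrable_on_compact\<close> each cut off to \<open>K\<close>.\<close>
    have "(\<lambda>x. h x * indicator K x * indicator K x) integrable_on cbox (- a) a"
    proof (rule measurable_bounded_by_integrable_imp_integrable)
      have "(\<lambda>x. h x * indicator K x * indicator K x) \<in> borel_measurable lebesgue"
        by measurable
      then show "(\<lambda>x. h x * indicator K x * indicator K x) \<in> borel_measurable (lebesgue_on (cbox (- a) a))"
        by (rule measurable_restrict_space1)
      show "(\<lambda>x. B) integrable_on cbox (- a) a" by (rule integrable_const)
      show "norm (h x * indicator K x * indicator K x) \<le> B" for x
        using B[of x] r[of x] N B0 by (cases "x \<in> K") auto
    qed auto
    with a show ?thesis unfolding henstock_integrable_on_compact_def by blast
  qed
  with meas show ?thesis by (simp add: HK_loc_def)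
qed

text \<open>Since \<open>h\<close> takes only powers of 2 and 0, its distribution function at
  \<open>t\<close> is \<open>u\<close> at the least power of 2 exceeding \<open>t\<close>. That
  power is at most \<open>2 * t\<close>, which accounts for the factor 2. Nonnegativity of
  \<open>u\<close> on positive arguments follows from monotonicity and the limit.\<close>

lemma HK_loc_with_distribution:
  fixes u :: "real \<Rightarrow> real"
  assumes mono: "\<And>s t. 0 < s \<Longrightarrow> s \<le> t \<Longrightarrow> u t \<le> u s"
    and lim: "(u \<longlongrightarrow> 0) at_top"
  obtains h :: "real ^ 'n \<Rightarrow> real"
  where "h \<in> HK_loc"
    "\<And>t. t > 0 \<Longrightarrow> ennreal (u (2 * t)) \<le> distribution_fun h t"
    "\<And>t. t > 0 \<Longrightarrow> distribution_fun h t \<le> ennreal (u t)"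
proof -
  define v where "v k = u (2 powr real_of_int k)" for k
  have v_antimono: "v (k + 1) \<le> v k" for k
    by (auto simp: v_def intro!: mono powr_mono)
  \<comment> \<open>The layers are indexed by all integers, the balls by naturals;
    \<open>int_decode\<close> and \<open>int_encode\<close> translate between the two.\<close>
  define m where "m j = v (int_decode j) - v (int_decode j + 1)" for j
  have m: "m j \<ge> 0" for j
    using v_antimono by (simp add: m_def)
  obtain E :: "nat \<Rightarrow> (real ^ 'n) set" where E:
    "\<And>j. E j \<in> sets lebesgue" "disjoint_family E"
    "\<And>j. emeasure lebesgue (E j) = ennreal (m j)"
    "\<And>j x. x \<in> E j \<Longrightarrow> real j \<le> norm x"
  proof (rule locally_finite_sets_with_measures[of m, OF m])
    fix E :: "nat \<Rightarrow> (real ^ 'n) set"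
    assume "\<And>j. E j \<in> sets lebesgue" "disjoint_family E"
      "\<And>j. emeasure lebesgue (E j) = ennreal (m j)" "\<And>j x. x \<in> E j \<Longrightarrow> real j \<le> norm x"
    then show thesis by (rule that)
  qed
  define F where "F k = E (int_encode k)" for k
  have F: "F k \<in> sets lebesgue" "emeasure lebesgue (F k) = ennreal (v k - v (k + 1))" for k
    using E(1,3) by (auto simp: F_def m_def)
  have F_eq: "k = l" if "x \<in> F k" "x \<in> F l" for x k l
    using that E(2) unfolding F_def disjoint_family_on_def
    by (metis UNIV_I disjoint_iff int_encode_inverse)
  define h where "h x = (if \<exists>k. x \<in> F k then 2 powr real_of_int (THE k. x \<in> F k) else 0)" for x
  have h_F: "h x = 2 powr real_of_int k" if "x \<in> F k" for x k
  proof -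
    have "(THE k. x \<in> F k) = k" using that F_eq by blast
    then show ?thesis using that by (auto simp: h_def)
  qed
  have h_0: "h x = 0" if "\<And>k. x \<notin> F k" for x
    using that by (simp add: h_def)
  have h_nonneg: "h x \<ge> 0" for x by (simp add: h_def)
  have level: "{x. t < h x} = (\<Union>k\<in>{k. t < 2 powr real_of_int k}. F k)" if "t \<ge> 0" for t
  proof (intro set_eqI)
    fix x
    show "x \<in> {x. t < h x} \<longleftrightarrow> x \<in> (\<Union>k\<in>{k. t < 2 powr real_of_int k}. F k)"
    proof (cases "\<exists>k. x \<in> F k")
      case True
      then obtain k where k: "x \<in> F k" by blast
      then have "x \<in> F l \<longleftrightarrow> l = k" for l using F_eq by blast
      then show ?thesis by (simp add: h_F[OF k])
    next
      case False
      then show ?thesis using h_0[of x] that by simp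
    qed
  qed
  have meas: "h \<in> borel_measurable lebesgue"
  proof (unfold borel_measurable_iff_greater, intro allI)
    fix t
    show "{x \<in> space lebesgue. t < h x} \<in> sets lebesgue"
    proof (cases "t \<ge> 0")
      case True
      then show ?thesis using F(1) by (auto simp: level intro!: sets.countable_UN')
    next
      case False
      then have "{x \<in> space lebesgue. t < h x} = space lebesgue"
        using h_nonneg by (auto simp: not_le intro: less_le_trans)
      then show ?thesis by (metis sets.top)
    qed
  qed
  have "\<exists>B. \<forall>x. norm x \<le> real N \<longrightarrow> \<bar>h x\<bar> \<le> B" for N :: nat
  proof (intro exI allI impI)
    fix x :: "real ^ 'n" assume x: "norm x \<le> real N"
    \<comment> \<open>A point of \<open>F k\<close> has norm at least \<open>int_encode k\<close>,
      so only the finitely many layers with code at most \<open>N\<close> can meet this ball. The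
      sum of their values bounds each of them.\<close>
    let ?B = "\<Sum>j\<le>N. 2 powr real_of_int (int_decode j)"
    show "\<bar>h x\<bar> \<le> ?B"
    proof (cases "\<exists>k. x \<in> F k")
      case True
      then obtain k where k: "x \<in> F k" by blast
      with E(4)[of x "int_encode k"] x have "int_encode k \<le> N" by (simp add: F_def)
      then have "2 powr real_of_int (int_decode (int_encode k)) \<le> ?B"
        by (intro member_le_sum) auto
      then show ?thesis by (simp add: h_F[OF k])
    next
      case False
      then show ?thesis by (simp add: h_0 sum_nonneg)
    qed
  qed
  with meas have HK: "h \<in> HK_loc" by (rule HK_loc_locally_bounded)
  have distr: "distribution_fun h t = ennreal (v (\<lfloor>log 2 t\<rfloor> + 1))" if t: "t > 0" for t
  proof -
    \<comment> \<open>The least integer with \<open>t < 2 powr K\<close>. The inequality is strict,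
      so if \<open>t\<close> is itself a power of 2, its own layer is excluded.\<close>
    define K where "K = \<lfloor>log 2 t\<rfloor> + 1"
    have "{k. t < 2 powr real_of_int k} = {K..}"
      using t by (auto simp: K_def less_powr_iff floor_less_iff[symmetric])
    also have "\<dots> = range (\<lambda>i. K + int i)"
    proof
      show "{K..} \<subseteq> range (\<lambda>i. K + int i)"
      proof
        fix k assume "k \<in> {K..}"
        then have "k = K + int (nat (k - K))" by simp
        then show "k \<in> range (\<lambda>i. K + int i)" by blast
      qed
    qed auto
    finally have "{x. \<bar>h x\<bar> > t} = (\<Union>i. F (K + int i))"
      using level[of t] t h_nonneg by simp
    moreover have "disjoint_family (\<lambda>i. F (K + int i))"
      unfolding disjoint_family_on_def
    proof (intro ballI impI)
      fix i j :: nat assume "i \<noteq> j"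
      then have "K + int i \<noteq> K + int j" by simp
      then show "F (K + int i) \<inter> F (K + int j) = {}" using F_eq by blast
    qed
    moreover have "range (\<lambda>i. F (K + int i)) \<subseteq> sets lebesgue" using F(1) by blast
    ultimately have "distribution_fun h t = (\<Sum>i. emeasure lebesgue (F (K + int i)))"
      unfolding distribution_fun_def
      by (simp only: suminf_emeasure)
    also have "\<dots> = (\<Sum>i. ennreal (v (K + int i) - v (K + int (Suc i))))"
      by (simp add: F(2) algebra_simps)
    also have "\<dots> = ennreal (v K)"
    proof (rule suminf_ennreal_eq)
      show "0 \<le> v (K + int i) - v (K + int (Suc i))" for i
        using v_antimono[of "K + int i"] by (simp add: algebra_simps)
      \<comment> \<open>The layer measures telescope; the decay of \<open>u\<close> at infinity
        removes the tail and leaves \<open>v K\<close>.\<close>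
      have "filterlim (\<lambda>i. 2 powr real_of_int (K + int i)) at_top sequentially"
        by real_asymp
      then have "(\<lambda>i. v (K + int i)) \<longlonglongrightarrow> 0"
        unfolding v_def by (rule filterlim_compose[OF lim])
      from telescope_sums'[OF this] show "(\<lambda>i. v (K + int i) - v (K + int (Suc i))) sums v K"
        by simp
    qed
    finally show ?thesis by (simp add: K_def)
  qed
  show thesis
  proof (rule that[OF HK])
    fix t :: real assume t: "t > 0"
    let ?s = "2 powr real_of_int (\<lfloor>log 2 t\<rfloor> + 1)"
    have s: "t \<le> ?s" "?s \<le> 2 * t"
    proof -
      have "2 powr log 2 t \<le> ?s" "?s \<le> 2 powr (log 2 t + 1)"
        by (rule powr_mono; linarith)+
      with t show "t \<le> ?s" "?s \<le> 2 * t" by (simp_all add: powr_add)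
    qed
    show "ennreal (u (2 * t)) \<le> distribution_fun h t" "distribution_fun h t \<le> ennreal (u t)"
      using mono[of ?s "2 * t"] mono[of t ?s] s t
      by (auto simp: distr v_def intro!: ennreal_leI)
  qed
qed

section \<open>The gauge in terms of admissible scalings, and passage to classes\<close>

text \<open>The division by \<open>\<alpha>\<close> is moved into the argument of one fixed
  distribution function, so that rescaling \<open>\<alpha>\<close> and substituting in
  \<open>t\<close> can be traded for each other.\<close>

definition weak_admissible :: "(real \<Rightarrow> ennreal) \<Rightarrow> (real ^ 'n \<Rightarrow> real) \<Rightarrow> real \<Rightarrow> bool" where
  "weak_admissible \<theta> h \<alpha> \<longleftrightarrow> \<alpha> > 0 \<and> (\<forall>t>0. \<theta> t * distribution_fun h (\<alpha> * t) \<le> 1)"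

lemma weak_gauge_eq: "weak_gauge \<theta> h = Inf (ennreal ` {\<alpha>. weak_admissible \<theta> h \<alpha>})"
proof -
  have "distribution_fun (\<lambda>x. h x / \<alpha>) t = distribution_fun h (\<alpha> * t)" if "\<alpha> > 0" for \<alpha> t
    using that by (simp add: distribution_fun_def field_simps)
  then have "{ennreal \<alpha> |\<alpha>. \<alpha> > 0 \<and>
      (SUP t\<in>{0<..}. \<theta> t * distribution_fun (\<lambda>x. h x / \<alpha>) t) \<le> 1}
      = ennreal ` {\<alpha>. weak_admissible \<theta> h \<alpha>}"
    by (auto simp: weak_admissible_def SUP_le_iff image_iff)
  then show ?thesis by (simp add: weak_gauge_def)
qed

lemma weak_gauge_less_top_iff: "weak_gauge \<theta> h < top \<longleftrightarrow> (\<exists>\<alpha>. weak_admissible \<theta> h \<alpha>)"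
  by (auto simp: weak_gauge_eq Inf_less_iff)

text \<open>Substituting \<open>C * t\<close> for \<open>t\<close> shows that if
  \<open>\<alpha>\<close> is admissible for \<open>\<theta>2\<close>, then
  \<open>C * \<alpha>\<close> is admissible for \<open>\<theta>1\<close>.\<close>

lemma weak_gauge_le_if_dominated:
  assumes C: "C > 0" and dom: "\<And>t. t \<ge> 0 \<Longrightarrow> \<theta>1 t \<le> \<theta>2 (C * t)"
  shows "weak_gauge \<theta>1 h \<le> ennreal C * weak_gauge \<theta>2 h"
proof -
  have *: "weak_gauge \<theta>1 h \<le> ennreal (C * \<alpha>)" if "weak_admissible \<theta>2 h \<alpha>" for \<alpha>
  proof -
    have "\<theta>1 t * distribution_fun h (C * \<alpha> * t) \<le> 1" if "t > 0" for t
    proof -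
      have "\<theta>1 t * distribution_fun h (C * \<alpha> * t) \<le> \<theta>2 (C * t) * distribution_fun h (\<alpha> * (C * t))"
        using dom[of t] that by (auto simp: mult_ac intro: mult_mono)
      also have "\<dots> \<le> 1"
        using \<open>weak_admissible \<theta>2 h \<alpha>\<close> that C by (simp add: weak_admissible_def)
      finally show ?thesis .
    qed
    then have "weak_admissible \<theta>1 h (C * \<alpha>)"
      using that C by (simp add: weak_admissible_def)
    then show ?thesis by (auto simp: weak_gauge_eq intro!: Inf_lower)
  qed
  \<comment> \<open>Dividing by \<open>C\<close> first leaves a bare infimum on the right, so a
    lower bound for every admissible \<open>\<alpha>\<close> suffices.\<close>
  have "weak_gauge \<theta>1 h / ennreal C \<le> weak_gauge \<theta>2 h"
    unfolding weak_gauge_eq[of \<theta>2]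
  proof (rule Inf_greatest, clarsimp)
    fix \<alpha> assume "weak_admissible \<theta>2 h \<alpha>"
    moreover have "ennreal (C * \<alpha>) = ennreal C * ennreal \<alpha>"
      using C by (intro ennreal_mult') simp
    ultimately have "weak_gauge \<theta>1 h \<le> ennreal C * ennreal \<alpha>"
      using *[of \<alpha>] by simp
    then show "weak_gauge \<theta>1 h / ennreal C \<le> ennreal \<alpha>"
      using C by (intro divide_le_posI_ennreal) simp_all
  qed
  then have "ennreal C * (weak_gauge \<theta>1 h / ennreal C) \<le> ennreal C * weak_gauge \<theta>2 h"
    by (rule mult_left_mono) simp
  moreover have "ennreal C * (weak_gauge \<theta>1 h / ennreal C) = weak_gauge \<theta>1 h"
    using C by (simp add: ennreal_times_divide mult_divide_eq_ennreal mult.commute[of "ennreal C"])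
  ultimately show ?thesis by simp
qed

text \<open>Forward, the class may have been formed from another representative, but the gauge is
  constant on the class. Backward, \<open>h\<close> itself is the representative.\<close>

lemma quotient_ae_class_iff:
  assumes "h \<in> HK_loc"
  shows "ae_equal `` {h} \<in> weak_henstock_orlicz \<theta> \<longleftrightarrow> weak_gauge \<theta> h < \<infinity>"
proof
  assume "ae_equal `` {h} \<in> weak_henstock_orlicz \<theta>"
  then obtain g where "weak_gauge \<theta> g < \<infinity>" "ae_equal `` {h} = ae_equal `` {g}"
    by (auto simp: weak_henstock_orlicz_def quotient_def)
  then show "weak_gauge \<theta> h < \<infinity>" by (metis weak_norm_class)
qed (use assms in \<open>auto simp: weak_henstock_orlicz_def quotient_def\<close>)

lemma weak_henstock_orliczE:
  assumes "c \<in> weak_henstock_orlicz \<theta>"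
  obtains h where "c = ae_equal `` {h}" "h \<in> HK_loc" "weak_gauge \<theta> h < \<infinity>"
  using assms by (auto simp: weak_henstock_orlicz_def quotient_def)

section \<open>Necessity of domination and the equivalence\<close>

lemma concave_youngD:
  assumes "\<theta> \<in> concave_young"
  shows "\<theta> 0 = 0" "\<And>s t. 0 \<le> s \<Longrightarrow> s \<le> t \<Longrightarrow> \<theta> s \<le> \<theta> t" "\<And>t. t > 0 \<Longrightarrow> \<theta> t > 0"
    "\<And>t. t \<ge> 0 \<Longrightarrow> \<theta> t < \<infinity>" "(\<theta> \<longlongrightarrow> \<infinity>) at_top"
proof -
  have sm: "strict_mono_on {0..} \<theta>" and b: "bij_betw \<theta> {0..} {y. y < \<infinity>}"
    and 0: "\<theta> 0 = 0" and lim: "(\<theta> \<longlongrightarrow> \<infinity>) at_top"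
    using assms by (auto simp: concave_young_def young_function_def)
  show "\<theta> 0 = 0" "(\<theta> \<longlongrightarrow> \<infinity>) at_top" by fact+
  show "\<theta> s \<le> \<theta> t" if "0 \<le> s" "s \<le> t" for s t
    using strict_mono_onD[OF sm, of s t] that by (cases "s = t") auto
  show "\<theta> t > 0" if "t > 0" for t
    using strict_mono_onD[OF sm, of 0 t] that 0 by simp
  show "\<theta> t < \<infinity>" if "t \<ge> 0" for t
    using bij_betwE[OF b] that by auto
qed

text \<open>The inclusion is applied to a single class, that of the test function built from
  \<open>1 / \<theta>2\<close>. The resulting constant is \<open>2 * \<alpha>\<close>: 2 from the
  dyadic layers, \<open>\<alpha>\<close> from the \<open>\<theta>1\<close>-admissibility of
  \<open>h\<close>.\<close>

lemma young_dominated_if_subset: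
  fixes \<theta>1 \<theta>2 :: "real \<Rightarrow> ennreal"
  assumes "\<theta>1 \<in> concave_young" and "\<theta>2 \<in> concave_young"
    and sub: "(weak_henstock_orlicz \<theta>2 :: (real ^ 'n \<Rightarrow> real) set set) \<subseteq> weak_henstock_orlicz \<theta>1"
  shows "young_dominated \<theta>1 \<theta>2"
proof -
  note \<theta>1 = concave_youngD[OF assms(1)] and \<theta>2 = concave_youngD[OF assms(2)]
  \<comment> \<open>For \<open>t > 0\<close> the value \<open>\<theta>2 t\<close> is positive and
    finite, so nothing is lost in passing to reals. At 0 the convention gives
    \<open>u 0 = 0\<close>, which is why only positive arguments are compared.\<close>
  define u where "u t = inverse (enn2real (\<theta>2 t))" for t
  have u: "ennreal (u t) = inverse (\<theta>2 t)" if "t > 0" for t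
  proof -
    have "enn2real (\<theta>2 t) > 0" using \<theta>2(3,4)[of t] that by (simp add: enn2real_positive_iff)
    then show ?thesis using \<theta>2(4)[of t] that by (simp add: u_def inverse_ennreal[symmetric])
  qed
  have u_mono: "u t \<le> u s" if "0 < s" "s \<le> t" for s t
  proof -
    have "enn2real (\<theta>2 s) > 0" using \<theta>2(3,4)[of s] that by (simp add: enn2real_positive_iff)
    moreover have "enn2real (\<theta>2 s) \<le> enn2real (\<theta>2 t)"
      using \<theta>2(2)[of s t] \<theta>2(4)[of t] that by (intro enn2real_mono) auto
    ultimately show ?thesis by (simp add: u_def le_imp_inverse_le)
  qed
  have u_lim: "(u \<longlongrightarrow> 0) at_top"
  proof (rule tendsto_ennrealD)
    have "((\<lambda>t. inverse (\<theta>2 t)) \<longlongrightarrow> inverse \<infinity>) at_top"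
      by (rule continuous_on_tendsto_compose[of UNIV inverse])
        (use \<theta>2(5) in \<open>auto intro: continuous_on_inverse_ennreal continuous_on_id\<close>)
    then have "((\<lambda>t. inverse (\<theta>2 t)) \<longlongrightarrow> ennreal 0) at_top" by simp
    then show "((\<lambda>t. ennreal (u t)) \<longlongrightarrow> ennreal 0) at_top"
    proof (rule Lim_transform_eventually)
      show "\<forall>\<^sub>F t in at_top. inverse (\<theta>2 t) = ennreal (u t)"
        using eventually_gt_at_top[of "0::real"] by eventually_elim (simp add: u)
    qed
  qed (auto simp: u_def)
  obtain h :: "real ^ 'n \<Rightarrow> real" where h: "h \<in> HK_loc"
    "\<And>t. t > 0 \<Longrightarrow> ennreal (u (2 * t)) \<le> distribution_fun h t"
    "\<And>t. t > 0 \<Longrightarrow> distribution_fun h t \<le> ennreal (u t)"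
    using HK_loc_with_distribution[OF u_mono u_lim] by blast
  have cancel: "\<theta>2 t * inverse (\<theta>2 t) = 1" if "t > 0" for t
    using \<theta>2(3,4)[of t] that by (simp add: ennreal_divide_self divide_ennreal_def[symmetric])
  have "\<theta>2 t * distribution_fun h (1 * t) \<le> 1" if "t > 0" for t
    using mult_left_mono[OF h(3)[OF that], of "\<theta>2 t"] u[OF that] cancel[OF that] by simp
  then have "weak_admissible \<theta>2 h 1" by (simp add: weak_admissible_def)
  then have "ae_equal `` {h} \<in> weak_henstock_orlicz \<theta>2"
    using h(1) by (auto simp: quotient_ae_class_iff weak_gauge_less_top_iff)
  with sub have "ae_equal `` {h} \<in> weak_henstock_orlicz \<theta>1" by blast
  with h(1) obtain \<alpha> where \<alpha>: "weak_admissible \<theta>1 h \<alpha>"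
    by (auto simp: quotient_ae_class_iff weak_gauge_less_top_iff)
  then have \<alpha>_pos: "\<alpha> > 0" by (simp add: weak_admissible_def)
  have "\<theta>1 t \<le> \<theta>2 (2 * \<alpha> * t)" if "t \<ge> 0" for t
  proof (cases "t = 0")
    case True
    then show ?thesis by (simp add: \<theta>1(1))
  next
    case False
    with that have t: "t > 0" by simp
    let ?y = "\<theta>2 (2 * \<alpha> * t)"
    have pos: "2 * \<alpha> * t > 0" using t \<alpha>_pos by simp
    \<comment> \<open>The lower bound on the distribution at \<open>\<alpha> * t\<close> is exactly
      \<open>1 / ?y\<close>; multiplying the resulting inequality by \<open>?y\<close> then gives
      the domination.\<close>
    have "\<theta>1 t * inverse ?y \<le> \<theta>1 t * distribution_fun h (\<alpha> * t)"
      using h(2)[of "\<alpha> * t"] t \<alpha>_pos u[OF pos] by (auto simp: mult.assoc intro!: mult_left_mono)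
    also have "\<dots> \<le> 1" using \<alpha> t by (simp add: weak_admissible_def)
    finally have "?y * (\<theta>1 t * inverse ?y) \<le> ?y * 1" by (rule mult_left_mono) simp
    moreover have "?y * (\<theta>1 t * inverse ?y) = \<theta>1 t * (?y * inverse ?y)" by (simp add: mult_ac)
    ultimately show ?thesis by (simp add: cancel[OF pos])
  qed
  then show ?thesis using \<alpha>_pos by (auto simp: young_dominated_def intro!: exI[of _ "2 * \<alpha>"])
qed

text \<open>Proved as a cycle: domination gives the norm bound, the norm bound gives the inclusion,
  and the inclusion gives domination.\<close>

theorem theorem5p5:
  fixes \<theta>1 \<theta>2 :: "real \<Rightarrow> ennreal"
  assumes "\<theta>1 \<in> concave_young" and "\<theta>2 \<in> concave_young"
  shows "(young_dominated \<theta>1 \<theta>2 \<longleftrightarrow>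
            (weak_henstock_orlicz \<theta>2 :: (real ^ 'n \<Rightarrow> real) set set) \<subseteq> weak_henstock_orlicz \<theta>1) \<and>
         ((weak_henstock_orlicz \<theta>2 :: (real ^ 'n \<Rightarrow> real) set set) \<subseteq> weak_henstock_orlicz \<theta>1 \<longleftrightarrow>
            (\<exists>C>0. \<forall>h \<in> (weak_henstock_orlicz \<theta>2 :: (real ^ 'n \<Rightarrow> real) set set).
               weak_norm \<theta>1 h \<le> ennreal C * weak_norm \<theta>2 h))"
    (is "(?dom \<longleftrightarrow> ?sub) \<and> (_ \<longleftrightarrow> ?bound)")
proof -
  have "?bound" if ?dom
  proof -
    from that obtain C where C: "C > 0" "\<And>t. t \<ge> 0 \<Longrightarrow> \<theta>1 t \<le> \<theta>2 (C * t)"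
      by (auto simp: young_dominated_def)
    show ?thesis
    proof (intro exI[of _ C] conjI ballI C(1))
      fix c :: "(real ^ 'n \<Rightarrow> real) set" assume "c \<in> weak_henstock_orlicz \<theta>2"
      then obtain h where "c = ae_equal `` {h}" by (rule weak_henstock_orliczE)
      moreover have "weak_gauge \<theta>1 h \<le> ennreal C * weak_gauge \<theta>2 h"
        by (rule weak_gauge_le_if_dominated) (use C in auto)
      ultimately show "weak_norm \<theta>1 c \<le> ennreal C * weak_norm \<theta>2 c"
        by (simp add: weak_norm_class)
    qed
  qed
  moreover have ?sub if ?bound
  proof
    fix c :: "(real ^ 'n \<Rightarrow> real) set" assume c: "c \<in> weak_henstock_orlicz \<theta>2"
    then obtain h where h: "c = ae_equal `` {h}" "h \<in> HK_loc" "weak_gauge \<theta>2 h < \<infinity>"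
      by (rule weak_henstock_orliczE)
    from that c obtain C where "weak_norm \<theta>1 c \<le> ennreal C * weak_norm \<theta>2 c" by blast
    then have "weak_gauge \<theta>1 h \<le> ennreal C * weak_gauge \<theta>2 h" by (simp add: h(1) weak_norm_class)
    also have "\<dots> < \<infinity>" using h(3) by (simp add: ennreal_mult_less_top)
    finally show "c \<in> weak_henstock_orlicz \<theta>1" using h(1,2) by (simp add: quotient_ae_class_iff)
  qed
  moreover have ?dom if ?sub
    using young_dominated_if_subset[OF assms that] .
  ultimately show ?thesis by blast
qed

end
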